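(* Fix $r\ge2$, an $r$-graph $H$ and $\delta\in(0,1)$. Let $p=p_n\in(0,1)$ be a sequence with $p=\omega(n^{-1/\Delta(H)})$. Let $\hat q=(1-\delta)^{1/e(H)}p$ and $q=\hat q\,\dfrac{n^r}{n(n-1)\cdots(n-r+1)}$. Then $$\mathrm{LT}_{n,p}(H,\delta)\le(1+o(1))\binom nr I_p\big((1-o(1))q\big).$$ Furthermore, if $H$ is a Sidorenko hypergraph, then (for all sufficiently large $n$) $$\mathrm{LT}_{n,p}(H,\delta)\ge\binom nr I_p(q).$$
   Context: An $r$-graph is a finite simple $r$-uniform hypergraph $H$ with vertex set $V(H)$, edge set $E(H)$, $v(H)=|V(H)|$, $e(H)=|E(H)|$, maximum vertex degree $\Delta(H)$. $\mathcal Q_{n,r}$ is the set of symmetric functions $Q:[n]^r\to[0,1]$ vanishing whenever the coordinates are not all distinct. For $Q\in\mathcal Q_{n,r}$, $t(H,Q)=n^{-v(H)}\sum_{\phi:V(H)\to[n]}\prod_{e\in E(H)}Q(\phi(e))$ with $Q(\phi(e))=Q(\phi(v_1),\dots,\phi(v_r))$ for $e=\{v_1,\dots,v_r\}$; $t(H,G)=t(H,A_G)$ for an $r$-graph $G$ on $[n]$ with adjacency tensor $A_G$. $\mathbf G$ is the random $r$-graph on $[n]$ with each $r$-subset an edge independently with probability $p$, and $\mathrm{LT}_{n,p}(H,\delta)=-\log\mathbb P\big(t(H,\mathbf G)\le(1-\delta)p^{e(H)}\big)$. For $x\in[0,1]$, $I_p(x)=x\log\frac xp+(1-x)\log\frac{1-x}{1-p}$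 (with $0\log 0=0$). $H$ is a Sidorenko hypergraph if for all $n$ and all $Q\in\mathcal Q_{n,r}$, $t(H,Q)\ge t(K_r^r,Q)^{e(H)}$, where $K^r_r$ is the $r$-graph consisting of a single edge on $r$ vertices, so $t(K_r^r,Q)=n^{-r}\sum_{(i_1,\dots,i_r)\in[n]^r}Q(i_1,\dots,i_r)$. $p=\omega(f)$ means $p/f\to\infty$ as $n\to\infty$; the first display means that there is $\eta_n\to0$, $\eta_n\ge0$, with $\mathrm{LT}_{n,p}(H,\delta)\le(1+\eta_n)\binom nr I_p((1-\eta_n)q)$ for all large $n$. *)

theory Defs
  imports "HOL-Probability.Probability" "HOL-Combinatorics.Permutations"
begin

record 'v hypergraph =
  verts :: "'v set"
  edges :: "'v set set"

definition r_graph :: "nat \<Rightarrow> 'v hypergraph \<Rightarrow> bool" where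
  "r_graph r H \<longleftrightarrow> finite (verts H) \<and> (\<forall>e\<in>edges H. e \<subseteq> verts H \<and> card e = r)"

definition vertex_degree :: "'v hypergraph \<Rightarrow> 'v \<Rightarrow> nat" where
  "vertex_degree H v = card {e \<in> edges H. v \<in> e}"

definition max_degree :: "'v hypergraph \<Rightarrow> nat" where
  "max_degree H = Max (vertex_degree H ` verts H)"

text \<open>The vertex set $[n]$ is \<^term>\<open>{1..n}\<close>, and an element of $[n]^r$ is a list of length $r$.\<close>

definition tuples :: "nat \<Rightarrow> nat \<Rightarrow> nat list set" where
  "tuples n r = {xs. length xs = r \<and> set xs \<subseteq> {1..n}}"

text \<open>The class $\mathcal Q_{n,r}$. Values of \<^term>\<open>Q\<close> outside \<^term>\<open>tuples n r\<close> are
  unconstrained and never used.\<close>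

definition sym_tensors :: "nat \<Rightarrow> nat \<Rightarrow> (nat list \<Rightarrow> real) set" where
  "sym_tensors n r = {Q. \<forall>xs\<in>tuples n r.
      0 \<le> Q xs \<and> Q xs \<le> 1
    \<and> (\<forall>\<sigma>. \<sigma> permutes {..<r} \<longrightarrow> Q (permute_list \<sigma> xs) = Q xs)
    \<and> (\<not> distinct xs \<longrightarrow> Q xs = 0)}"

text \<open>$Q(\phi(e))$, for an arbitrarily chosen enumeration $v_1,\dots,v_r$ of $e$. The choice does
  not matter when \<^term>\<open>Q\<close> is symmetric; see \<open>edge_value_eq\<close> below.\<close>

definition edge_value :: "(nat list \<Rightarrow> real) \<Rightarrow> ('v \<Rightarrow> nat) \<Rightarrow> 'v set \<Rightarrow> real" where
  "edge_value Q \<phi> e = Q (map \<phi> (SOME vs. distinct vs \<and> set vs = e))"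

definition hom_density :: "nat \<Rightarrow> 'v hypergraph \<Rightarrow> (nat list \<Rightarrow> real) \<Rightarrow> real" where
  "hom_density n H Q =
     (\<Sum>\<phi> \<in> verts H \<rightarrow>\<^sub>E {1..n}. \<Prod>e\<in>edges H. edge_value Q \<phi> e) / real n ^ card (verts H)"

text \<open>For an \<^term>\<open>r\<close>-graph and a list of length \<^term>\<open>r\<close>, \<^prop>\<open>set xs \<in> edges G\<close> forces the
  entries of \<^term>\<open>xs\<close> to be distinct.\<close>

definition adj_tensor :: "nat hypergraph \<Rightarrow> nat list \<Rightarrow> real" where
  "adj_tensor G xs = of_bool (set xs \<in> edges G)"

definition random_r_graph :: "nat \<Rightarrow> nat \<Rightarrow> real \<Rightarrow> nat hypergraph pmf" where
  "random_r_graph n r p =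
     map_pmf (\<lambda>\<omega>. \<lparr>verts = {1..n}, edges = {e. \<omega> e}\<rparr>)
       (Pi_pmf {e. e \<subseteq> {1..n} \<and> card e = r} False (\<lambda>_. bernoulli_pmf p))"

text \<open>If $H$ has an edge and $0 < p < 1$ then the probability below is positive, as the edgeless
  graph belongs to the event, so the convention \<^prop>\<open>ln (0::real) = 0\<close> plays no role.\<close>

definition LT_rate :: "nat \<Rightarrow> nat \<Rightarrow> real \<Rightarrow> 'v hypergraph \<Rightarrow> real \<Rightarrow> real" where
  "LT_rate n r p H \<delta> =
     - ln (measure_pmf.prob (random_r_graph n r p)
             {G. hom_density n H (adj_tensor G) \<le> (1 - \<delta>) * p ^ card (edges H)})"

text \<open>The convention $0 \log 0 = 0$ is automatic from the zero factor.\<close>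

definition I_ent :: "real \<Rightarrow> real \<Rightarrow> real" where
  "I_ent p x = x * ln (x / p) + (1 - x) * ln ((1 - x) / (1 - p))"

definition single_edge :: "nat \<Rightarrow> nat hypergraph" where
  "single_edge r = \<lparr>verts = {1..r}, edges = {{1..r}}\<rparr>"

definition sidorenko :: "nat \<Rightarrow> 'v hypergraph \<Rightarrow> bool" where
  "sidorenko r H \<longleftrightarrow> (\<forall>n\<ge>1. \<forall>Q\<in>sym_tensors n r.
     hom_density n H Q \<ge> hom_density n (single_edge r) Q ^ card (edges H))"

definition q_hat :: "'v hypergraph \<Rightarrow> real \<Rightarrow> real \<Rightarrow> real" where
  "q_hat H \<delta> p = (1 - \<delta>) powr (1 / real (card (edges H))) * p"

definition q_val :: "nat \<Rightarrow> nat \<Rightarrow> 'v hypergraph \<Rightarrow> real \<Rightarrow> real \<Rightarrow> real" where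
  "q_val n r H \<delta> p = q_hat H \<delta> p * (real n ^ r / (\<Prod>i<r. real n - real i))"

lemma edge_value_eq:
  assumes Q: "Q \<in> sym_tensors n r" and vs: "distinct vs" "set vs = e" "length vs = r"
    and \<phi>: "\<phi> ` e \<subseteq> {1..n}"
  shows "edge_value Q \<phi> e = Q (map \<phi> vs)"
proof -
  define ws where "ws = (SOME vs. distinct vs \<and> set vs = e)"
  have ws: "distinct ws" "set ws = e"
    using someI[of "\<lambda>vs. distinct vs \<and> set vs = e" vs] vs by (auto simp: ws_def)
  have "mset (map \<phi> ws) = mset (map \<phi> vs)"
    using ws vs set_eq_iff_mset_eq_distinct[of ws vs] by simp
  then obtain \<sigma> where \<sigma>: "\<sigma> permutes {..<length (map \<phi> vs)}"
      "permute_list \<sigma> (map \<phi> vs) = map \<phi> ws"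
    by (rule mset_eq_permutation)
  have "map \<phi> vs \<in> tuples n r"
    using vs \<phi> by (auto simp: tuples_def)
  then have "Q (map \<phi> ws) = Q (map \<phi> vs)"
    using Q \<sigma> vs unfolding sym_tensors_def by (metis (mono_tags, lifting) length_map mem_Collect_eq)
  then show ?thesis
    by (simp add: edge_value_def ws_def)
qed

lemma adj_tensor_sym_tensors:
  assumes "r_graph r G"
  shows "adj_tensor G \<in> sym_tensors n r"
  using assms
  by (auto simp: sym_tensors_def adj_tensor_def tuples_def r_graph_def distinct_card
      dest: card_distinct)

end

theory Submission imports Defs begin

text \<open>
  Upper bound: for \<open>m\<close> slightly above \<open>(1 - \<epsilon>) q N\<close> with \<open>N = n choose r\<close>, keep only the graphs with
  exactly \<open>m\<close> edges. Averaged over these, the density of \<open>H\<close> is at most \<open>(1 + o(1)) (m / N)\<close> to the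
  power \<open>e(H)\<close>, since maps that identify \<open>j\<close> vertices lose at most \<open>j \<Delta>(H)\<close> edges and
  \<open>n (m / N) ^ \<Delta>(H)\<close> tends to infinity. By Markov's inequality a positive proportion, depending only
  on \<open>\<epsilon>\<close>, of the graphs with \<open>m\<close> edges has small density, and the binomial probability of \<open>m\<close> edges
  is \<open>exp (- N I\<^sub>p (m / N))\<close> up to a factor \<open>N + 1\<close>. As \<open>N p\<close> grows at least linearly in \<open>n\<close>, the
  logarithm of all the lost factors is \<open>o(N I\<^sub>p)\<close>. Finally \<open>\<epsilon>\<close> is sent to zero along a diagonal.

  Lower bound: by the Sidorenko property the event forces at most \<open>q N\<close> edges, and the Chernoff
  bound applies.
\<close>

subsection \<open>Random hypergraphs and homomorphism densities\<close>

definition r_sets :: "nat \<Rightarrow> nat \<Rightarrow> nat set set" where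
  "r_sets n r = {e. e \<subseteq> {1..n} \<and> card e = r}"

lemma finite_r_sets [simp, intro]: "finite (r_sets n r)"
  by (rule finite_subset[of _ "Pow {1..n}"]) (auto simp: r_sets_def)

lemma card_r_sets [simp]: "card (r_sets n r) = n choose r"
  using n_subsets[of "{1..n}" r] by (simp add: r_sets_def)

text \<open>Independence gives each family \<open>E\<close> of \<open>r\<close>-sets a product
  weight that depends only on \<open>card E\<close>. All later probability estimates become finite
  weighted counts of edge sets.\<close>

lemma prob_random_r_graph:
  assumes "0 \<le> p" "p \<le> 1"
  shows "measure_pmf.prob (random_r_graph n r p) A =
    (\<Sum>E | E \<subseteq> r_sets n r \<and> \<lparr>verts = {1..n}, edges = E\<rparr> \<in> A. p ^ card E * (1 - p) ^ ((n choose r) - card E))"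
proof -
  let ?S = "r_sets n r" and ?G = "\<lambda>E. \<lparr>verts = {1..n}, edges = E\<rparr>"
  define M where "M = map_pmf Collect (Pi_pmf ?S False (\<lambda>_. bernoulli_pmf p))"
  have G: "random_r_graph n r p = map_pmf ?G M"
    by (simp add: random_r_graph_def M_def r_sets_def pmf.map_comp o_def)
  have pmf_M: "pmf M E = (if E \<subseteq> ?S then p ^ card E * (1 - p) ^ ((n choose r) - card E) else 0)" for E
  proof -
    have "pmf M (Collect (\<lambda>e. e \<in> E)) = pmf (Pi_pmf ?S False (\<lambda>_. bernoulli_pmf p)) (\<lambda>e. e \<in> E)"
      unfolding M_def by (rule pmf_map_inj') (auto simp: inj_def)
    also have "\<dots> = (if E \<subseteq> ?S then \<Prod>e\<in>?S. pmf (bernoulli_pmf p) (e \<in> E) else 0)"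
      by (subst pmf_Pi) auto
    finally have *: "pmf M E = (if E \<subseteq> ?S then \<Prod>e\<in>?S. pmf (bernoulli_pmf p) (e \<in> E) else 0)"
      by simp
    have "(\<Prod>e\<in>?S. pmf (bernoulli_pmf p) (e \<in> E)) = p ^ card E * (1 - p) ^ ((n choose r) - card E)"
      if "E \<subseteq> ?S"
    proof -
      have "finite E" using that finite_subset by blast
      have "(\<Prod>e\<in>?S. pmf (bernoulli_pmf p) (e \<in> E)) = (\<Prod>e\<in>?S. if e \<in> E then p else 1 - p)"
        using assms by (intro prod.cong) auto
      also have "\<dots> = (\<Prod>e\<in>?S \<inter> {e. e \<in> E}. p) * (\<Prod>e\<in>?S \<inter> - {e. e \<in> E}. 1 - p)"
        by (rule prod.If_cases) simp
      also have "?S \<inter> {e. e \<in> E} = E" using that by auto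
      also have "?S \<inter> - {e. e \<in> E} = ?S - E" by auto
      finally show ?thesis using that \<open>finite E\<close> by (simp add: card_Diff_subset)
    qed
    with * show ?thesis by simp
  qed
  have set_M: "set_pmf M \<subseteq> Pow ?S"
    using pmf_M by (auto simp: set_pmf_iff split: if_splits)
  have "measure_pmf.prob (random_r_graph n r p) A = measure_pmf.prob M (?G -` A)"
    by (simp add: G)
  also have "\<dots> = measure_pmf.prob M {E. E \<subseteq> ?S \<and> ?G E \<in> A}"
    by (rule measure_prob_cong_0) (use pmf_M in auto)
  also have "\<dots> = (\<Sum>E | E \<subseteq> ?S \<and> ?G E \<in> A. pmf M E)"
    by (rule measure_measure_pmf_finite) (auto intro: finite_subset[of _ "Pow ?S"])
  also have "\<dots> = (\<Sum>E | E \<subseteq> ?S \<and> ?G E \<in> A. p ^ card E * (1 - p) ^ ((n choose r) - card E))"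
    by (intro sum.cong) (auto simp: pmf_M)
  finally show ?thesis .
qed

text \<open>\<open>adj_tensor\<close> sees only the set of entries of a list, so any enumeration
  picked by \<open>SOME\<close> gives the same value; finiteness of \<open>e\<close> ensures that an
  enumeration exists.\<close>

lemma edge_value_adj_tensor:
  assumes "finite e"
  shows "edge_value (adj_tensor G) \<phi> e = of_bool (\<phi> ` e \<in> edges G)"
proof -
  have "\<exists>vs. distinct vs \<and> set vs = e"
    using finite_distinct_list[OF assms] by auto
  then have "set (SOME vs. distinct vs \<and> set vs = e) = e"
    by (rule someI2_ex) simp
  then show ?thesis by (simp add: edge_value_def adj_tensor_def)
qed

lemma r_graph_finite:
  assumes "r_graph r H"
  shows "finite (verts H)" "finite (edges H)" "e \<in> edges H \<Longrightarrow> finite e"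
  using assms unfolding r_graph_def
  by (auto intro: finite_subset[of _ "Pow (verts H)"] finite_subset[of e "verts H"])

lemma hom_density_adj_tensor:
  assumes "r_graph r H"
  shows "hom_density n H (adj_tensor G) =
    card {\<phi> \<in> verts H \<rightarrow>\<^sub>E {1..n}. \<forall>e\<in>edges H. \<phi> ` e \<in> edges G} / real n ^ card (verts H)"
proof -
  have *: "(\<Prod>e\<in>edges H. edge_value (adj_tensor G) \<phi> e) = of_bool (\<forall>e\<in>edges H. \<phi> ` e \<in> edges G)" for \<phi>
  proof -
    have "(\<Prod>e\<in>edges H. edge_value (adj_tensor G) \<phi> e) = (\<Prod>e\<in>edges H. of_bool (\<phi> ` e \<in> edges G))"
      by (intro prod.cong refl edge_value_adj_tensor r_graph_finite(3)[OF assms])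
    then show ?thesis using r_graph_finite(2)[OF assms]
      by (auto simp: prod_zero_iff)
  qed
  have "finite (verts H \<rightarrow>\<^sub>E {1..n})"
    using r_graph_finite(1)[OF assms] by (intro finite_PiE) auto
  then show ?thesis
    unfolding hom_density_def * by (subst sum_of_bool_eq) (simp_all add: Int_def)
qed

text \<open>Equal cardinality makes every such injection a bijection. Composing the permutations of
  \<open>A\<close> with one fixed bijection \<open>h\<close> from \<open>A\<close> to
  \<open>B\<close> lists each of them exactly once.\<close>

lemma card_inj_maps_onto:
  assumes "finite A" "finite B" "card A = card B"
  shows "card {f \<in> A \<rightarrow>\<^sub>E B. inj_on f A} = fact (card A)"
proof -
  obtain h where h: "bij_betw h A B"
    using finite_same_card_bij assms by blast
  have "bij_betw (\<lambda>\<sigma>. restrict (h \<circ> \<sigma>) A) {\<sigma>. \<sigma> permutes A} {f \<in> A \<rightarrow>\<^sub>E B. inj_on f A}"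
  proof (rule bij_betwI')
    fix \<sigma> \<tau> assume *: "\<sigma> \<in> {\<sigma>. \<sigma> permutes A}" "\<tau> \<in> {\<sigma>. \<sigma> permutes A}"
    show "restrict (h \<circ> \<sigma>) A = restrict (h \<circ> \<tau>) A \<longleftrightarrow> \<sigma> = \<tau>"
    proof
      assume eq: "restrict (h \<circ> \<sigma>) A = restrict (h \<circ> \<tau>) A"
      have "\<sigma> x = \<tau> x" for x
      proof (cases "x \<in> A")
        case True
        then have "h (\<sigma> x) = h (\<tau> x)" using fun_cong[OF eq, of x] by simp
        moreover have "\<sigma> x \<in> A" "\<tau> x \<in> A" using True * by (simp_all add: permutes_in_image)
        ultimately show ?thesis using h by (auto simp: bij_betw_def inj_on_def)
      next
        case False
        then show ?thesis using * by (simp add: permutes_not_in)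
      qed
      then show "\<sigma> = \<tau>" by blast
    qed simp
  next
    fix \<sigma> assume "\<sigma> \<in> {\<sigma>. \<sigma> permutes A}"
    then have "bij_betw (h \<circ> \<sigma>) A B" using h by (auto intro: bij_betw_trans permutes_imp_bij)
    then show "restrict (h \<circ> \<sigma>) A \<in> {f \<in> A \<rightarrow>\<^sub>E B. inj_on f A}"
      by (auto simp: bij_betw_def inj_on_def)
  next
    fix f assume f: "f \<in> {f \<in> A \<rightarrow>\<^sub>E B. inj_on f A}"
    have "f ` A = B" using f assms by (intro card_subset_eq) (auto simp: card_image)
    then have "bij_betw f A B" using f by (simp add: bij_betw_def)
    then have bij: "bij_betw (inv_into A h \<circ> f) A A"
      using bij_betw_trans bij_betw_inv_into[OF h] by blast
    define \<sigma> where "\<sigma> x = (if x \<in> A then inv_into A h (f x) else x)" for x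
    have "bij_betw \<sigma> A A" using bij by (subst bij_betw_cong[of A \<sigma>]) (auto simp: \<sigma>_def)
    then have "\<sigma> permutes A" by (rule bij_imp_permutes) (simp add: \<sigma>_def)
    moreover have "f x = restrict (h \<circ> \<sigma>) A x" for x
    proof (cases "x \<in> A")
      case True
      then have "f x \<in> h ` A" using f h by (auto simp: bij_betw_def)
      then show ?thesis using True by (simp add: \<sigma>_def f_inv_into_f)
    next
      case False
      then show ?thesis using f by (auto simp: PiE_def extensional_def)
    qed
    ultimately show "\<exists>\<sigma>\<in>{\<sigma>. \<sigma> permutes A}. f = restrict (h \<circ> \<sigma>) A" by blast
  qed
  then have "card {f \<in> A \<rightarrow>\<^sub>E B. inj_on f A} = card {\<sigma>. \<sigma> permutes A}"
    by (simp add: bij_betw_same_card)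
  then show ?thesis using assms by (simp add: card_permutations)
qed

text \<open>A map whose image is an edge determines that edge, and each edge is the image of
  \<open>fact r\<close> bijections; the maps counted by the density split into disjoint classes of
  equal size.\<close>

lemma hom_density_single_edge:
  assumes "edges G \<subseteq> r_sets n r"
  shows "hom_density n (single_edge r) (adj_tensor G) = fact r * card (edges G) / real n ^ r"
proof -
  let ?F = "\<lambda>e. {\<phi> \<in> {1..r} \<rightarrow>\<^sub>E e. inj_on \<phi> {1..r}}"
  have fin: "finite e" "card e = r" "e \<subseteq> {1..n}" if "e \<in> edges G" for e
    using that assms finite_subset[of e "{1..n}"] by (auto simp: r_sets_def)
  have img: "\<phi> ` {1..r} = e" if "\<phi> \<in> ?F e" "e \<in> edges G" for \<phi> e
    using that fin[of e] by (intro card_subset_eq) (auto simp: card_image)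
  have "{\<phi> \<in> {1..r} \<rightarrow>\<^sub>E {1..n}. \<phi> ` {1..r} \<in> edges G} = (\<Union>e\<in>edges G. ?F e)"
  proof (intro equalityI subsetI)
    fix \<phi> assume "\<phi> \<in> {\<phi> \<in> {1..r} \<rightarrow>\<^sub>E {1..n}. \<phi> ` {1..r} \<in> edges G}"
    then have *: "\<phi> \<in> {1..r} \<rightarrow>\<^sub>E {1..n}" "\<phi> ` {1..r} \<in> edges G" by auto
    then have "\<phi> \<in> ?F (\<phi> ` {1..r})"
      using fin[OF *(2)] by (auto intro!: eq_card_imp_inj_on simp: PiE_def)
    then show "\<phi> \<in> (\<Union>e\<in>edges G. ?F e)" using * by blast
  next
    fix \<phi> assume "\<phi> \<in> (\<Union>e\<in>edges G. ?F e)"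
    then obtain e where e: "e \<in> edges G" "\<phi> \<in> ?F e" by auto
    with img[OF e(2,1)] fin[OF e(1)]
    show "\<phi> \<in> {\<phi> \<in> {1..r} \<rightarrow>\<^sub>E {1..n}. \<phi> ` {1..r} \<in> edges G}" by (auto simp: PiE_iff)
  qed
  moreover have "card (\<Union>e\<in>edges G. ?F e) = (\<Sum>e\<in>edges G. card (?F e))"
  proof (rule card_UN_disjoint)
    show "finite (edges G)" using assms finite_subset by blast
    show "\<forall>e\<in>edges G. finite (?F e)"
    proof
      fix e assume "e \<in> edges G"
      then have "finite ({1..r} \<rightarrow>\<^sub>E e)" using fin by (intro finite_PiE) auto
      then show "finite (?F e)" by simp
    qed
    show "\<forall>e\<in>edges G. \<forall>e'\<in>edges G. e \<noteq> e' \<longrightarrow> ?F e \<inter> ?F e' = {}"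
    proof (intro ballI impI)
      fix e e' assume *: "e \<in> edges G" "e' \<in> edges G" "e \<noteq> e'"
      show "?F e \<inter> ?F e' = {}"
      proof (rule equals0I)
        fix \<phi> assume "\<phi> \<in> ?F e \<inter> ?F e'"
        then show False using img[OF _ *(1), of \<phi>] img[OF _ *(2), of \<phi>] *(3) by simp
      qed
    qed
  qed
  moreover have "(\<Sum>e\<in>edges G. card (?F e)) = (\<Sum>e\<in>edges G. fact r)"
    using fin by (intro sum.cong refl) (subst card_inj_maps_onto, simp_all)
  moreover have "r_graph r (single_edge r)" by (simp add: r_graph_def single_edge_def)
  ultimately show ?thesis
    by (subst hom_density_adj_tensor[of r]) (simp_all add: single_edge_def)
qed

subsection \<open>The entropy function and binomial probabilities\<close>

lemma prod_diff_eq_fact_choose: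
  "(\<Prod>i<r. real n - real i) = fact r * real (n choose r)"
proof -
  have "real (n choose r) = (\<Prod>i = 0..<r. real n - real i) / fact r"
    by (simp add: binomial_gbinomial gbinomial_prod_rev)
  then show ?thesis by (simp add: lessThan_atLeast0)
qed

text \<open>The inequality \<open>ln t \<le> t - 1\<close> at \<open>t = (1 - p) / (1 - x)\<close>
  replaces the second entropy term by a linear one.\<close>

lemma I_ent_lower:
  assumes "0 < p" "p < 1" "0 < x" "x < 1"
  shows "x * ln (x / p) + p - x \<le> I_ent p x"
proof -
  have "- ln ((1 - x) / (1 - p)) = ln ((1 - p) / (1 - x))"
    using assms by (simp add: ln_div)
  also have "\<dots> \<le> (1 - p) / (1 - x) - 1" using assms by (intro ln_le_minus_one) auto
  finally have "(1 - x) * (1 - (1 - p) / (1 - x)) \<le> (1 - x) * ln ((1 - x) / (1 - p))"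
    using assms by (intro mult_left_mono) auto
  moreover have "(1 - x) * (1 - (1 - p) / (1 - x)) = p - x" using assms by (simp add: field_simps)
  ultimately show ?thesis by (simp add: I_ent_def)
qed

lemma I_ent_nonneg:
  assumes "0 < p" "p < 1" "0 < x" "x < 1"
  shows "0 \<le> I_ent p x"
proof -
  have "- ln (x / p) = ln (p / x)" using assms by (simp add: ln_div)
  also have "\<dots> \<le> p / x - 1" using assms by (intro ln_le_minus_one) auto
  finally have "x * (1 - p / x) \<le> x * ln (x / p)" using assms by (intro mult_left_mono) auto
  moreover have "x * (1 - p / x) = x - p" using assms by (simp add: field_simps)
  ultimately show ?thesis using I_ent_lower[OF assms] by simp
qed

text \<open>With \<open>x \<le> y \<le> p\<close> the difference \<open>I p x - I p y\<close> is \<open>I y x\<close> plus a nonnegative multiple of \<open>y - x\<close>.\<close>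

lemma I_ent_antimono:
  assumes "0 < p" "p < 1" "0 < x" "x \<le> y" "y \<le> p"
  shows "I_ent p y \<le> I_ent p x"
proof -
  have "0 \<le> I_ent y x" using assms by (intro I_ent_nonneg) auto
  moreover have "ln y \<le> ln p" "ln (1 - p) \<le> ln (1 - y)" using assms by auto
  then have "0 \<le> (y - x) * ((ln (1 - y) - ln (1 - p)) - (ln y - ln p))"
    using assms by (intro mult_nonneg_nonneg) linarith+
  moreover have "I_ent p x - I_ent p y = I_ent y x + (y - x) * ((ln (1 - y) - ln (1 - p)) - (ln y - ln p))"
    using assms by (simp add: I_ent_def ln_div algebra_simps)
  ultimately show ?thesis by linarith
qed

text \<open>At a fixed fraction of \<open>p\<close> the entropy is at least of order
  \<open>p\<close>, the constant being positive by \<open>rate_pos\<close>. This is what absorbs the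
  logarithmic errors.\<close>

lemma I_ent_linear_lower:
  assumes "0 < p" "p < 1" "0 < \<theta>" "\<theta> < 1"
  shows "p * (\<theta> * ln \<theta> + 1 - \<theta>) \<le> I_ent p (\<theta> * p)"
proof -
  have "\<theta> * p < 1 * 1" using assms by (intro mult_strict_mono) auto
  then have "\<theta> * p * ln (\<theta> * p / p) + p - \<theta> * p \<le> I_ent p (\<theta> * p)"
    using assms by (intro I_ent_lower) auto
  then show ?thesis using assms by (simp add: algebra_simps)
qed

text \<open>Equality in \<open>ln t \<le> t - 1\<close> holds only at \<open>t = 1\<close>, and here
  \<open>t = 1 / \<theta>\<close> exceeds 1.\<close>

lemma rate_pos:
  fixes \<theta> :: real
  assumes "0 < \<theta>" "\<theta> < 1"
  shows "0 < \<theta> * ln \<theta> + 1 - \<theta>"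
proof -
  have "ln (1 / \<theta>) < 1 / \<theta> - 1"
    using assms ln_less_self[of "1/\<theta>"] ln_le_minus_one[of "1/\<theta>"] ln_eq_minus_one[of "1/\<theta>"] by fastforce
  then have "\<theta> * (1 - 1 / \<theta>) < \<theta> * ln \<theta>"
    using assms by (intro mult_strict_left_mono) (auto simp: ln_div)
  then show ?thesis using assms by (simp add: right_diff_distrib)
qed

text \<open>The form needed for a change of measure: the likelihood ratio of edge probabilities
  \<open>p\<close> and \<open>x\<close> at \<open>x * N\<close> edges is exactly this
  product.\<close>

lemma exp_neg_I_ent:
  assumes "0 < p" "p < 1" "0 < x" "x < 1"
  shows "exp (- real N * I_ent p x) = (p / x) powr (x * N) * ((1 - p) / (1 - x)) powr ((1 - x) * N)"
  using assms by (simp add: powr_def I_ent_def ln_div algebra_simps flip: exp_add)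

section \<open>Binomial weights on subsets: total mass, lower tail and mode\<close>

lemma sum_subsets_binomial:
  fixes x :: real
  assumes "finite S"
  shows "(\<Sum>E\<in>Pow S. x ^ card E * (1 - x) ^ (card S - card E)) = 1"
proof -
  have "(\<Sum>E\<in>Pow S. x ^ card E * (1 - x) ^ (card S - card E)) =
      (\<Sum>k\<le>card S. \<Sum>E | E \<in> Pow S \<and> card E = k. x ^ card E * (1 - x) ^ (card S - card E))"
    using assms by (intro sum.group[symmetric]) (auto simp: card_mono)
  also have "\<dots> = (\<Sum>k\<le>card S. of_nat (card S choose k) * x ^ k * (1 - x) ^ (card S - k))"
  proof (intro sum.cong refl)
    fix k
    have "(\<Sum>E | E \<in> Pow S \<and> card E = k. x ^ card E * (1 - x) ^ (card S - card E)) =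
        (\<Sum>E | E \<in> Pow S \<and> card E = k. x ^ k * (1 - x) ^ (card S - k))"
      by (intro sum.cong) auto
    then show "(\<Sum>E | E \<in> Pow S \<and> card E = k. x ^ card E * (1 - x) ^ (card S - card E)) =
        of_nat (card S choose k) * x ^ k * (1 - x) ^ (card S - k)"
      using n_subsets[OF assms, of k] by simp
  qed
  also have "\<dots> = 1"
    using binomial_ring[of x "1 - x" "card S"] by simp
  finally show ?thesis .
qed

text \<open>Change of measure from \<open>p\<close> to \<open>q\<close>: for at most
  \<open>q * card S\<close> elements the likelihood ratio is at most its value at
  \<open>q * card S\<close>, which is the exponential, and the \<open>q\<close>-weights sum to
  1.\<close>

lemma sum_subsets_lower_tail:
  fixes p q :: real
  assumes "finite S" "0 < q" "q \<le> p" "p < 1"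
  shows "(\<Sum>E | E \<subseteq> S \<and> card E \<le> q * card S. p ^ card E * (1 - p) ^ (card S - card E))
    \<le> exp (- real (card S) * I_ent p q)"
proof -
  let ?N = "card S"
  have le: "p ^ k * (1 - p) ^ (?N - k) \<le> exp (- real ?N * I_ent p q) * (q ^ k * (1 - q) ^ (?N - k))"
    if "k \<le> q * ?N" "k \<le> ?N" for k
  proof -
    \<comment> \<open>The base \<open>p / q\<close> is at least 1 and \<open>k\<close> is at most
      \<open>q * ?N\<close>; in the next estimate the base is at most 1 and the exponent at least
      \<open>(1 - q) * ?N\<close>.\<close>
    have "(p / q) powr k \<le> (p / q) powr (q * ?N)"
      using assms that by (intro powr_mono) auto
    moreover have "((1 - p) / (1 - q)) powr real (?N - k) \<le> ((1 - p) / (1 - q)) powr ((1 - q) * ?N)"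
      using assms that by (intro powr_mono') (auto simp: algebra_simps of_nat_diff)
    ultimately have "(p / q) powr k * ((1 - p) / (1 - q)) powr real (?N - k) \<le> exp (- real ?N * I_ent p q)"
      using assms by (subst exp_neg_I_ent) (auto intro!: mult_mono)
    then have "(p / q) ^ k * ((1 - p) / (1 - q)) ^ (?N - k) \<le> exp (- real ?N * I_ent p q)"
      using assms by (simp add: powr_realpow)
    then have "(p / q) ^ k * ((1 - p) / (1 - q)) ^ (?N - k) * (q ^ k * (1 - q) ^ (?N - k)) \<le>
        exp (- real ?N * I_ent p q) * (q ^ k * (1 - q) ^ (?N - k))"
      using assms by (intro mult_right_mono) auto
    moreover have "(p / q) ^ k * ((1 - p) / (1 - q)) ^ (?N - k) * (q ^ k * (1 - q) ^ (?N - k)) =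
        p ^ k * (1 - p) ^ (?N - k)"
      using assms by (simp add: power_divide)
    ultimately show ?thesis by simp
  qed
  have "(\<Sum>E | E \<subseteq> S \<and> card E \<le> q * ?N. p ^ card E * (1 - p) ^ (?N - card E))
      \<le> (\<Sum>E | E \<subseteq> S \<and> card E \<le> q * ?N. exp (- real ?N * I_ent p q) * (q ^ card E * (1 - q) ^ (?N - card E)))"
    using assms by (intro sum_mono le) (auto simp: card_mono)
  also have "\<dots> \<le> (\<Sum>E\<in>Pow S. exp (- real ?N * I_ent p q) * (q ^ card E * (1 - q) ^ (?N - card E)))"
    using assms by (intro sum_mono2) auto
  also have "\<dots> = exp (- real ?N * I_ent p q)"
    using sum_subsets_binomial[OF assms(1), of q] by (simp flip: sum_distrib_left)
  finally show ?thesis .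
qed

text \<open>The binomial distribution with parameters \<open>N\<close> and \<open>m / N\<close> has its mode at \<open>m\<close>.\<close>

lemma binomial_mode_lower:
  assumes "0 < m" "m < N" and x: "x = real m / real N"
  shows "1 / (real N + 1) \<le> real (N choose m) * x ^ m * (1 - x) ^ (N - m)"
proof -
  define f where "f k = real (N choose k) * x ^ k * (1 - x) ^ (N - k)" for k
  have x01: "0 < x" "x < 1" using assms by auto
  \<comment> \<open>The ratio of consecutive terms, cleared of denominators; comparing the two
    factors shows growth up to \<open>m\<close> and decrease afterwards.\<close>
  have step: "f (Suc k) * (real (Suc k) * (1 - x)) = f k * (real (N - k) * x)" if "k < N" for k
  proof -
    have "real (Suc k) * real (N choose Suc k) = real (N - k) * real (N choose k)"
      by (metis binomial_absorb_comp binomial_absorption mult.commute of_nat_mult that)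
    moreover have "(1 - x) ^ (N - k) = (1 - x) ^ (N - Suc k) * (1 - x)"
      using that by (metis Suc_diff_Suc power_Suc2)
    ultimately show ?thesis unfolding f_def by (simp add: mult_ac)
  qed
  have fpos: "0 \<le> f k" for k unfolding f_def using x01 by simp
  have up: "f k \<le> f (Suc k)" if "k < m" for k
  proof -
    have "real (Suc k) * (1 - x) \<le> real (N - k) * x"
    proof -
      have "real (Suc k) * (1 - x) \<le> real m * (1 - x)" using that x01 by (intro mult_right_mono) auto
      also have "\<dots> = real (N - m) * x" using assms by (simp add: field_simps of_nat_diff)
      also have "\<dots> \<le> real (N - k) * x" using that x01 by (intro mult_right_mono) auto
      finally show ?thesis .
    qed
    then have "f k * (real (Suc k) * (1 - x)) \<le> f (Suc k) * (real (Suc k) * (1 - x))"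
      using mult_left_mono[OF _ fpos[of k]] step[of k] that assms(2) by (metis order.strict_trans)
    then show ?thesis using x01 by (simp add: mult_le_cancel_right)
  qed
  have down: "f (Suc k) \<le> f k" if "m \<le> k" "k < N" for k
  proof -
    have "real (N - k) * x \<le> real (Suc k) * (1 - x)"
    proof -
      have "real (N - k) * x \<le> real (N - m) * x" using that x01 by (intro mult_right_mono) auto
      also have "\<dots> = real m * (1 - x)" using assms by (simp add: field_simps of_nat_diff)
      also have "\<dots> \<le> real (Suc k) * (1 - x)" using that x01 by (intro mult_right_mono) auto
      finally show ?thesis .
    qed
    then have "f (Suc k) * (real (Suc k) * (1 - x)) \<le> f k * (real (Suc k) * (1 - x))"
      using mult_left_mono[OF _ fpos[of k]] step[of k] that assms(2) by metis
    then show ?thesis using x01 by (simp add: mult_le_cancel_right)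
  qed
  have "f k \<le> f m" if "k \<le> N" for k
  proof (cases "k \<le> m")
    case True
    then show ?thesis
      by (induction rule: inc_induct) (auto intro: order_trans[OF up])
  next
    case False
    then have "m \<le> k" by simp
    then show ?thesis using that
      by (induction rule: dec_induct) (auto intro: order_trans[OF down])
  qed
  \<comment> \<open>The \<open>N + 1\<close> terms sum to 1, so the largest is at least their
    average.\<close>
  then have "(\<Sum>k\<le>N. f k) \<le> (\<Sum>k\<le>N. f m)" by (intro sum_mono) auto
  moreover have "(\<Sum>k\<le>N. f k) = 1"
    using binomial_ring[of x "1 - x" N] by (simp add: f_def)
  ultimately have "1 \<le> (real N + 1) * f m" by (simp add: add.commute)
  then show ?thesis by (simp add: f_def field_simps)
qed

subsection \<open>The mean density over hypergraphs with a given number of edges\<close>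

lemma vertex_degree_le_max_degree:
  assumes "r_graph r H" "v \<in> verts H"
  shows "vertex_degree H v \<le> max_degree H"
  unfolding max_degree_def using assms r_graph_finite(1)[OF assms(1)] by (intro Max_ge) auto

text \<open>Edges inside a set of representatives of the fibres of \<open>\<phi>\<close> have distinct images, and each
  of the other edges meets one of the remaining vertices.\<close>

lemma card_edges_le_image:
  assumes "r_graph r H"
  shows "card (edges H) \<le> card ((`) \<phi> ` edges H) + max_degree H * (card (verts H) - card (\<phi> ` verts H))"
proof -
  note fin = r_graph_finite[OF assms]
  obtain R where R: "R \<subseteq> verts H" "inj_on \<phi> R" "\<phi> ` verts H = \<phi> ` R"
    using subset_image_inj[of "\<phi> ` verts H" \<phi> "verts H"] by auto
  let ?A = "{e \<in> edges H. e \<subseteq> R}" and ?B = "\<Union>v\<in>verts H - R. {e \<in> edges H. v \<in> e}"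
  have "edges H \<subseteq> ?A \<union> ?B" using assms by (fastforce simp: r_graph_def)
  then have "card (edges H) \<le> card (?A \<union> ?B)"
    using fin by (intro card_mono) auto
  also have "\<dots> \<le> card ?A + card ?B" by (rule card_Un_le)
  also have "card ?A = card ((`) \<phi> ` ?A)"
  proof (rule card_image[symmetric], rule inj_onI)
    fix e e' assume "e \<in> ?A" "e' \<in> ?A" "\<phi> ` e = \<phi> ` e'"
    then show "e = e'" using R(2) inj_on_image_eq_iff[of \<phi> R e e'] by auto
  qed
  also have "\<dots> \<le> card ((`) \<phi> ` edges H)" using fin by (intro card_mono) auto
  also have "card ?B \<le> (\<Sum>v\<in>verts H - R. vertex_degree H v)"
    unfolding vertex_degree_def using fin by (intro card_UN_le) auto
  also have "\<dots> \<le> (\<Sum>v\<in>verts H - R. max_degree H)"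
    using vertex_degree_le_max_degree[OF assms] by (intro sum_mono) auto
  also have "\<dots> = max_degree H * (card (verts H) - card (\<phi> ` verts H))"
    using fin R finite_subset[OF R(1)] by (simp add: card_Diff_subset card_image)
  finally show ?thesis by simp
qed

text \<open>Choose the image among at most \<open>n ^ k\<close> sets of size \<open>k\<close>, then
  a map into it; \<open>k ^ card V\<close> is enlarged to a bound free of \<open>k\<close>.\<close>

lemma card_maps_image_card_le:
  assumes "finite V" "k \<le> card V"
  shows "card {\<phi> \<in> V \<rightarrow>\<^sub>E {1..n}. card (\<phi> ` V) = k} \<le> n ^ k * card V ^ card V"
proof -
  let ?T = "{T. T \<subseteq> {1..n} \<and> card T = k}"
  have finT: "finite ?T" by (rule finite_subset[of _ "Pow {1..n}"]) auto
  have finP: "finite (V \<rightarrow>\<^sub>E T)" if "T \<in> ?T" for T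
    using that assms finite_subset[of T "{1..n}"] by (intro finite_PiE) auto
  have "{\<phi> \<in> V \<rightarrow>\<^sub>E {1..n}. card (\<phi> ` V) = k} \<subseteq> (\<Union>T\<in>?T. V \<rightarrow>\<^sub>E T)"
  proof
    fix \<phi> assume \<phi>: "\<phi> \<in> {\<phi> \<in> V \<rightarrow>\<^sub>E {1..n}. card (\<phi> ` V) = k}"
    then have "\<phi> ` V \<in> ?T" "\<phi> \<in> V \<rightarrow>\<^sub>E \<phi> ` V" by (auto simp: PiE_iff)
    then show "\<phi> \<in> (\<Union>T\<in>?T. V \<rightarrow>\<^sub>E T)" by blast
  qed
  then have "card {\<phi> \<in> V \<rightarrow>\<^sub>E {1..n}. card (\<phi> ` V) = k} \<le> card (\<Union>T\<in>?T. V \<rightarrow>\<^sub>E T)"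
    using finT finP by (intro card_mono) auto
  also have "\<dots> \<le> (\<Sum>T\<in>?T. card (V \<rightarrow>\<^sub>E T))"
    using finT by (rule card_UN_le)
  also have "\<dots> = (\<Sum>T\<in>?T. k ^ card V)"
    using assms by (intro sum.cong) (auto simp: card_PiE)
  also have "\<dots> = (n choose k) * k ^ card V"
    using n_subsets[of "{1..n}" k] by simp
  also have "\<dots> \<le> n ^ k * card V ^ card V"
  proof (rule mult_mono)
    show "n choose k \<le> n ^ k"
      by (cases "k \<le> n") (auto simp: binomial_le_pow binomial_eq_0)
    show "k ^ card V \<le> card V ^ card V" using assms by (intro power_mono) auto
  qed auto
  finally show ?thesis .
qed

text \<open>Elements are removed one at a time: each removal costs exactly the current ratio
  \<open>m / N\<close>, and \<open>m \<le> N\<close> ensures that lowering both numbers by one does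
  not increase this ratio.\<close>

lemma binomial_diff_le:
  assumes "f \<le> m" "m \<le> N"
  shows "real ((N - f) choose (m - f)) \<le> real (N choose m) * (real m / real N) ^ f"
  using assms
proof (induction f arbitrary: m N)
  case (Suc f)
  then obtain m' N' where m: "m = Suc m'" "N = Suc N'" by (metis Suc_le_D le_trans)
  have le: "f \<le> m'" "m' \<le> N'" using Suc.prems m by auto
  have "real ((N - Suc f) choose (m - Suc f)) \<le> real (N' choose m') * (real m' / real N') ^ f"
    using Suc.IH[OF le] m by simp
  also have "\<dots> \<le> real (N' choose m') * (real m / real N) ^ f"
  proof (intro mult_left_mono power_mono)
    show "real m' / real N' \<le> real m / real N"
      \<comment> \<open>For \<open>N' = 0\<close> the left side is 0, since division by zero gives
        0.\<close>
      using le m by (cases "N' = 0") (auto simp: field_simps)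
  qed auto
  also have "real (N' choose m') = real (N choose m) * (real m / real N)"
  proof -
    have "real (Suc m') * real (Suc N' choose Suc m') = real (Suc N') * real (N' choose m')"
      by (metis binomial_absorption of_nat_mult Suc_times_binomial mult.commute)
    then show ?thesis unfolding m by (simp add: field_simps)
  qed
  finally show ?case by (simp add: mult_ac)
qed auto

text \<open>Deleting \<open>F\<close> is a bijection onto smaller subsets of \<open>S - F\<close>;
  if \<open>F\<close> is not inside \<open>S\<close> or is larger than \<open>m\<close>, nothing is
  counted. In effect a uniform \<open>m\<close>-subset contains \<open>F\<close> with at most the
  probability given by independent choices.\<close>

lemma card_supersets_le:
  assumes "finite S" "m \<le> card S"
  shows "real (card {E. E \<subseteq> S \<and> card E = m \<and> F \<subseteq> E}) \<le>
    real (card S choose m) * (real m / real (card S)) ^ card F"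
proof (cases "F \<subseteq> S \<and> card F \<le> m")
  case True
  then have finF: "finite F" using assms finite_subset by blast
  have "bij_betw (\<lambda>E. E - F) {E. E \<subseteq> S \<and> card E = m \<and> F \<subseteq> E} {E. E \<subseteq> S - F \<and> card E = m - card F}"
  proof (rule bij_betw_byWitness[where f' = "\<lambda>E. E \<union> F"])
    show "(\<lambda>E. E - F) ` {E. E \<subseteq> S \<and> card E = m \<and> F \<subseteq> E} \<subseteq> {E. E \<subseteq> S - F \<and> card E = m - card F}"
      using finF by (auto simp: card_Diff_subset)
    show "(\<lambda>E. E \<union> F) ` {E. E \<subseteq> S - F \<and> card E = m - card F} \<subseteq> {E. E \<subseteq> S \<and> card E = m \<and> F \<subseteq> E}"
    proof (intro subsetI, elim imageE)
      fix E' E assume E: "E' = E \<union> F" "E \<in> {E. E \<subseteq> S - F \<and> card E = m - card F}"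
      have "finite E" using E assms finite_subset[of E S] by auto
      then have "card (E \<union> F) = card E + card F" using E finF by (intro card_Un_disjoint) auto
      then show "E' \<in> {E. E \<subseteq> S \<and> card E = m \<and> F \<subseteq> E}" using E True by auto
    qed
  qed auto
  then have "card {E. E \<subseteq> S \<and> card E = m \<and> F \<subseteq> E} = (card S - card F) choose (m - card F)"
    using n_subsets[of "S - F" "m - card F"] assms True finF
    by (simp add: bij_betw_same_card card_Diff_subset)
  then show ?thesis using True assms binomial_diff_le by auto
next
  case False
  have "{E. E \<subseteq> S \<and> card E = m \<and> F \<subseteq> E} = {}"
  proof (rule equals0I)
    fix E assume E: "E \<in> {E. E \<subseteq> S \<and> card E = m \<and> F \<subseteq> E}"
    then have "finite E" using assms finite_subset by blast
    then have "card F \<le> m" using E card_mono[of E F] by auto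
    then show False using E False by auto
  qed
  then show ?thesis by (simp only: card.empty of_nat_0) simp
qed

text \<open>After swapping the sums, each map counts the families containing its image edges. Every
  vertex lost by identification raises the weight of a map by at most a factor
  \<open>1 / x ^ max_degree H\<close> but saves a factor \<open>n\<close> in the number of maps; the
  net effect is a factor \<open>1 / y\<close>.\<close>

lemma sum_hom_density_le:
  assumes H: "r_graph r H" and n: "n \<ge> 1" and m: "0 < m" "m \<le> n choose r"
    and x: "x = real m / real (n choose r)" and y: "y = real n * x ^ max_degree H" "1 \<le> y"
  shows "(\<Sum>E | E \<subseteq> r_sets n r \<and> card E = m. hom_density n H (adj_tensor \<lparr>verts = {1..n}, edges = E\<rparr>))
    \<le> real ((n choose r) choose m) * (x ^ card (edges H) * (1 + real (card (verts H) ^ (card (verts H) + 1)) / y))"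
proof -
  let ?S = "r_sets n r" and ?V = "verts H" and ?e = "card (edges H)" and ?d = "max_degree H"
  let ?v = "card ?V" and ?\<Phi> = "verts H \<rightarrow>\<^sub>E {1..n}" and ?C = "real ((n choose r) choose m)"
  note fin = r_graph_finite[OF H]
  have fin\<Phi>: "finite ?\<Phi>" using fin by (intro finite_PiE) auto
  have finE: "finite {E. E \<subseteq> ?S \<and> card E = m}" by (rule finite_subset[of _ "Pow ?S"]) auto
  have x01: "0 < x" "x \<le> 1" using m unfolding x by (simp_all add: divide_le_eq_1 zero_less_divide_iff del: zero_less_binomial_iff)
  \<comment> \<open>Bounds the weight of a map with \<open>k\<close> image vertices. Where the
    subtraction truncates, the exponent 0 gives the trivial bound 1.\<close>
  define g where "g k = x ^ (?e - ?d * (?v - k))" for k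
  have eq: "(\<Sum>E | E \<subseteq> ?S \<and> card E = m. hom_density n H (adj_tensor \<lparr>verts = {1..n}, edges = E\<rparr>))
      = (\<Sum>E | E \<subseteq> ?S \<and> card E = m. (\<Sum>\<phi>\<in>?\<Phi>. of_bool ((`) \<phi> ` edges H \<subseteq> E))) / real n ^ ?v"
  proof (subst sum_divide_distrib, intro sum.cong refl)
    fix E
    have "{\<phi> \<in> ?\<Phi>. \<forall>e\<in>edges H. \<phi> ` e \<in> E} = ?\<Phi> \<inter> {\<phi>. (`) \<phi> ` edges H \<subseteq> E}" by auto
    then show "hom_density n H (adj_tensor \<lparr>verts = {1..n}, edges = E\<rparr>) =
        (\<Sum>\<phi>\<in>?\<Phi>. of_bool ((`) \<phi> ` edges H \<subseteq> E)) / real n ^ ?v"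
      using fin\<Phi> by (simp add: hom_density_adj_tensor[OF H])
  qed
  have "(\<Sum>E | E \<subseteq> ?S \<and> card E = m. (\<Sum>\<phi>\<in>?\<Phi>. of_bool ((`) \<phi> ` edges H \<subseteq> E))) =
      (\<Sum>\<phi>\<in>?\<Phi>. \<Sum>E | E \<subseteq> ?S \<and> card E = m. of_bool ((`) \<phi> ` edges H \<subseteq> E))"
    by (rule sum.swap)
  also have "\<dots> = (\<Sum>\<phi>\<in>?\<Phi>. real (card {E. E \<subseteq> ?S \<and> card E = m \<and> (`) \<phi> ` edges H \<subseteq> E}))"
  proof (intro sum.cong refl)
    fix \<phi>
    have "{E. E \<subseteq> ?S \<and> card E = m \<and> (`) \<phi> ` edges H \<subseteq> E} = {E. E \<subseteq> ?S \<and> card E = m} \<inter> {E. (`) \<phi> ` edges H \<subseteq> E}"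
      by auto
    then show "(\<Sum>E | E \<subseteq> ?S \<and> card E = m. of_bool ((`) \<phi> ` edges H \<subseteq> E)) =
        real (card {E. E \<subseteq> ?S \<and> card E = m \<and> (`) \<phi> ` edges H \<subseteq> E})"
      using finE by simp
  qed
  also have "\<dots> \<le> (\<Sum>\<phi>\<in>?\<Phi>. ?C * g (card (\<phi> ` ?V)))"
  proof (rule sum_mono)
    fix \<phi>
    have "real (card {E. E \<subseteq> ?S \<and> card E = m \<and> (`) \<phi> ` edges H \<subseteq> E}) \<le> ?C * x ^ card ((`) \<phi> ` edges H)"
      using card_supersets_le[of ?S m "(`) \<phi> ` edges H"] m by (simp add: x)
    also have "\<dots> \<le> ?C * g (card (\<phi> ` ?V))"
      unfolding g_def using x01 card_edges_le_image[OF H, of \<phi>]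
      by (intro mult_left_mono power_decreasing) auto
    finally show "real (card {E. E \<subseteq> ?S \<and> card E = m \<and> (`) \<phi> ` edges H \<subseteq> E}) \<le> ?C * g (card (\<phi> ` ?V))" .
  qed
  also have "\<dots> = ?C * (\<Sum>k\<le>?v. \<Sum>\<phi> | \<phi> \<in> ?\<Phi> \<and> card (\<phi> ` ?V) = k. g (card (\<phi> ` ?V)))"
    unfolding sum_distrib_left[symmetric] using fin fin\<Phi>
    by (subst sum.group[of ?\<Phi> "{..?v}" "\<lambda>\<phi>. card (\<phi> ` ?V)"]) (auto intro: card_image_le)
  finally have le: "(\<Sum>E | E \<subseteq> ?S \<and> card E = m. (\<Sum>\<phi>\<in>?\<Phi>. of_bool ((`) \<phi> ` edges H \<subseteq> E)))
      \<le> ?C * (\<Sum>k\<le>?v. \<Sum>\<phi> | \<phi> \<in> ?\<Phi> \<and> card (\<phi> ` ?V) = k. g (card (\<phi> ` ?V)))" .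
  have "(\<Sum>k\<le>?v. \<Sum>\<phi> | \<phi> \<in> ?\<Phi> \<and> card (\<phi> ` ?V) = k. g (card (\<phi> ` ?V))) =
      (\<Sum>k\<le>?v. real (card {\<phi> \<in> ?\<Phi>. card (\<phi> ` ?V) = k}) * g k)"
    by (intro sum.cong) auto
  also have "\<dots> = (\<Sum>k<?v. real (card {\<phi> \<in> ?\<Phi>. card (\<phi> ` ?V) = k}) * g k) +
      real (card {\<phi> \<in> ?\<Phi>. card (\<phi> ` ?V) = ?v}) * g ?v"
    by (simp add: lessThan_Suc_atMost[symmetric])
  \<comment> \<open>The term \<open>k = ?v\<close> is the main one, bounded by counting all maps.
    The \<open>?v\<close> others each carry \<open>1 / y\<close>, whence the exponent
    \<open>?v + 1\<close> in the error.\<close>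
  also have "\<dots> \<le> (\<Sum>k<?v. real (?v ^ ?v) * (real n ^ ?v * x ^ ?e / y)) + real n ^ ?v * x ^ ?e"
  proof (intro add_mono sum_mono)
    fix k assume k: "k \<in> {..<?v}"
    have "real (card {\<phi> \<in> ?\<Phi>. card (\<phi> ` ?V) = k}) \<le> real (n ^ k * ?v ^ ?v)"
      using card_maps_image_card_le[OF fin(1), of k n] k by (simp only: of_nat_le_iff) simp
    then have "real (card {\<phi> \<in> ?\<Phi>. card (\<phi> ` ?V) = k}) * g k \<le> real (n ^ k * ?v ^ ?v) * g k"
      using x01 by (intro mult_right_mono) (auto simp: g_def)
    also have "\<dots> = real (?v ^ ?v) * (real n ^ k * g k)" by simp
    also have "real n ^ k * g k \<le> real n ^ ?v * x ^ ?e / y"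
    proof -
      have "g k * x ^ (?d * (?v - k)) \<le> x ^ ?e"
        unfolding g_def power_add[symmetric] using x01 by (intro power_decreasing) auto
      then have "real n ^ ?v * (g k * x ^ (?d * (?v - k))) \<le> real n ^ ?v * x ^ ?e"
        by (intro mult_left_mono) auto
      moreover have "real n ^ ?v = real n ^ k * real n ^ (?v - k)"
        using k by (simp flip: power_add)
      then have "real n ^ ?v * (g k * x ^ (?d * (?v - k))) = real n ^ k * g k * y ^ (?v - k)"
        by (simp add: y power_mult_distrib power_mult)
      ultimately have "real n ^ k * g k * y ^ (?v - k) \<le> real n ^ ?v * x ^ ?e" by simp
      \<comment> \<open>As \<open>1 \<le> y\<close> and \<open>k < ?v\<close>, one of the
        \<open>?v - k\<close> factors \<open>y\<close> is enough.\<close>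
      moreover have "y \<le> y ^ (?v - k)" using k y by (intro self_le_power) auto
      then have "real n ^ k * g k * y \<le> real n ^ k * g k * y ^ (?v - k)"
        using x01 by (intro mult_left_mono) (auto simp: g_def)
      ultimately show ?thesis using y by (simp add: field_simps)
    qed
    finally show "real (card {\<phi> \<in> ?\<Phi>. card (\<phi> ` ?V) = k}) * g k \<le> real (?v ^ ?v) * (real n ^ ?v * x ^ ?e / y)"
      by (simp add: mult_left_mono)
  next
    have "card {\<phi> \<in> ?\<Phi>. card (\<phi> ` ?V) = ?v} \<le> card ?\<Phi>" using fin\<Phi> by (intro card_mono) auto
    also have "\<dots> = n ^ ?v" using fin by (simp add: card_PiE)
    finally have "real (card {\<phi> \<in> ?\<Phi>. card (\<phi> ` ?V) = ?v}) \<le> real (n ^ ?v)"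
      by (simp only: of_nat_le_iff)
    then show "real (card {\<phi> \<in> ?\<Phi>. card (\<phi> ` ?V) = ?v}) * g ?v \<le> real n ^ ?v * x ^ ?e"
      unfolding g_def using x01 by (simp add: mult_right_mono)
  qed
  also have "\<dots> = real n ^ ?v * (x ^ ?e * (1 + real (?v ^ (?v + 1)) / y))"
    by (simp add: distrib_left)
  finally have "?C * (\<Sum>k\<le>?v. \<Sum>\<phi> | \<phi> \<in> ?\<Phi> \<and> card (\<phi> ` ?V) = k. g (card (\<phi> ` ?V)))
      \<le> ?C * (real n ^ ?v * (x ^ ?e * (1 + real (?v ^ (?v + 1)) / y)))"
    by (intro mult_left_mono) auto
  from order_trans[OF le this] show ?thesis
    unfolding eq using n by (subst pos_divide_le_eq) (simp_all only: mult_ac zero_less_power of_nat_0_less_iff)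
qed

subsection \<open>Bounds for the lower tail\<close>

text \<open>Markov's inequality for the uniform measure on \<open>A\<close>: the elements with value
  above \<open>T\<close> make up at most the fraction \<open>1 - c\<close>.\<close>

lemma card_sum_Markov:
  fixes f :: "'a \<Rightarrow> real"
  assumes "finite A" "\<And>a. a \<in> A \<Longrightarrow> 0 \<le> f a" "0 < T" "(\<Sum>a\<in>A. f a) \<le> real (card A) * (T * (1 - c))"
  shows "c * real (card A) \<le> real (card {a \<in> A. f a \<le> T})"
proof -
  let ?B = "{a \<in> A. f a \<le> T}"
  have "real (card (A - ?B)) * T = (\<Sum>a\<in>A - ?B. T)" by simp
  also have "\<dots> \<le> (\<Sum>a\<in>A - ?B. f a)" by (intro sum_mono) auto
  also have "\<dots> \<le> (\<Sum>a\<in>A. f a)" using assms by (intro sum_mono2) auto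
  also have "\<dots> \<le> (real (card A) * (1 - c)) * T" using assms(4) by (simp add: mult_ac)
  finally have "real (card (A - ?B)) \<le> real (card A) * (1 - c)" using assms(3) by simp
  moreover have "real (card (A - ?B)) = real (card A) - real (card ?B)"
    using assms(1) card_mono[of A ?B] by (subst card_Diff_subset) (auto simp: of_nat_diff)
  ultimately show ?thesis by (simp add: algebra_simps)
qed

lemma hom_density_adj_nonneg:
  assumes "r_graph r H"
  shows "0 \<le> hom_density n H (adj_tensor G)"
  by (simp add: hom_density_adj_tensor[OF assms])

text \<open>Only families with exactly \<open>m\<close> edges are kept. They share one weight, which
  is the entropy exponential times their weight under edge probability \<open>x\<close>;
  \<open>binomial_mode_lower\<close> then accounts for the logarithm of
  \<open>(n choose r) + 1\<close>.\<close>

lemma LT_rate_le: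
  assumes p: "0 < p" "p < 1" and m: "0 < m" "m < n choose r" and c: "0 < c"
    and x: "x = real m / real (n choose r)"
    and count: "c * real ((n choose r) choose m) \<le> real (card {E \<in> {E. E \<subseteq> r_sets n r \<and> card E = m}.
      hom_density n H (adj_tensor \<lparr>verts = {1..n}, edges = E\<rparr>) \<le> (1 - \<delta>) * p ^ card (edges H)})"
  shows "LT_rate n r p H \<delta> \<le> real (n choose r) * I_ent p x + ln (real (n choose r) + 1) - ln c"
proof -
  let ?N = "n choose r"
  let ?G = "\<lambda>E. \<lparr>verts = {1..n}, edges = E\<rparr>"
  let ?P = "\<lambda>E. hom_density n H (adj_tensor (?G E)) \<le> (1 - \<delta>) * p ^ card (edges H)"
  define Z where "Z = measure_pmf.prob (random_r_graph n r p)
             {G. hom_density n H (adj_tensor G) \<le> (1 - \<delta>) * p ^ card (edges H)}"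
  have *: "0 < real m" "real m < real ?N" using m by simp_all
  then have "0 < real ?N" by linarith
  then have x01: "0 < x" "x < 1"
    unfolding x using * by (simp_all only: divide_less_eq_1_pos divide_pos_pos)
  have xN: "x * ?N = m" "(1 - x) * ?N = real (?N - m)" using m(2) \<open>0 < real ?N\<close> by (simp_all add: x left_diff_distrib of_nat_diff)
  have "exp (- real ?N * I_ent p x) * (x ^ m * (1 - x) ^ (?N - m)) = p ^ m * (1 - p) ^ (?N - m)"
    unfolding exp_neg_I_ent[OF p x01] xN using p x01 by (simp add: powr_realpow power_divide)
  then have eq: "p ^ m * (1 - p) ^ (?N - m) * (c * real (?N choose m)) =
      c * exp (- real ?N * I_ent p x) * (real (?N choose m) * x ^ m * (1 - x) ^ (?N - m))"
    by (simp add: mult_ac)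
  have "c * exp (- real ?N * I_ent p x) * (1 / (real ?N + 1)) \<le> p ^ m * (1 - p) ^ (?N - m) * (c * real (?N choose m))"
    unfolding eq using binomial_mode_lower[OF m x] c by (intro mult_left_mono) auto
  also have "\<dots> \<le> p ^ m * (1 - p) ^ (?N - m) * real (card {E \<in> {E. E \<subseteq> r_sets n r \<and> card E = m}. ?P E})"
    using count p by (intro mult_left_mono) auto
  also have "\<dots> = (\<Sum>E\<in>{E \<in> {E. E \<subseteq> r_sets n r \<and> card E = m}. ?P E}. p ^ card E * (1 - p) ^ (?N - card E))"
    by simp
  also have "\<dots> \<le> (\<Sum>E | E \<subseteq> r_sets n r \<and> ?P E. p ^ card E * (1 - p) ^ (?N - card E))"
    using p by (intro sum_mono2) (auto intro: finite_subset[of _ "Pow (r_sets n r)"])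
  also have "\<dots> = Z" unfolding Z_def using p by (subst prob_random_r_graph) auto
  finally have le: "c * exp (- real ?N * I_ent p x) * (1 / (real ?N + 1)) \<le> Z" .
  have "ln (c * exp (- real ?N * I_ent p x) * (1 / (real ?N + 1))) \<le> ln Z"
    using c by (intro ln_mono[OF le]) auto
  moreover have "ln (c * exp (- real ?N * I_ent p x) * (1 / (real ?N + 1))) = ln c - real ?N * I_ent p x - ln (real ?N + 1)"
    using c by (simp add: ln_mult ln_div)
  ultimately show ?thesis by (simp add: LT_rate_def Z_def)
qed

text \<open>Explains the correction factor in \<open>q_val\<close>: \<open>q_hat\<close> is a
  density among all \<open>n ^ r\<close> tuples, and \<open>q_val\<close> is the matching edge
  density among the \<open>n choose r\<close> sets.\<close>

lemma q_val_times_choose: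
  assumes "r \<le> n"
  shows "q_val n r H \<delta> p * real (n choose r) = q_hat H \<delta> p * real n ^ r / fact r"
proof -
  have "0 < n choose r" using assms by simp
  then show ?thesis by (simp add: q_val_def prod_diff_eq_fact_choose)
qed

lemma q_hat_power:
  assumes "0 < p" "\<delta> < 1" "card (edges H) > 0"
  shows "q_hat H \<delta> p ^ card (edges H) = (1 - \<delta>) * p ^ card (edges H)"
  using assms by (simp add: q_hat_def power_mult_distrib powr_power)

text \<open>Taking the root of order \<open>card (edges H)\<close> in the Sidorenko inequality
  bounds the single edge density by \<open>q_hat\<close>, hence the number of edges by
  \<open>q_val\<close> times \<open>n choose r\<close>; \<open>sum_subsets_lower_tail\<close> then
  applies.\<close>

lemma LT_rate_ge:
  assumes H: "r_graph r H" and e: "card (edges H) > 0" and sid: "sidorenko r H"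
    and \<delta>: "\<delta> < 1" and p: "0 < p" "p < 1" and n: "1 \<le> n" "r \<le> n" and q: "q_val n r H \<delta> p \<le> p"
  shows "real (n choose r) * I_ent p (q_val n r H \<delta> p) \<le> LT_rate n r p H \<delta>"
proof -
  let ?S = "r_sets n r" and ?N = "n choose r" and ?q = "q_val n r H \<delta> p" and ?e = "card (edges H)"
  let ?G = "\<lambda>E. \<lparr>verts = {1..n}, edges = E\<rparr>"
  define A where "A = {G. hom_density n H (adj_tensor G) \<le> (1 - \<delta>) * p ^ ?e}"
  have qh: "0 < q_hat H \<delta> p" using p \<delta> by (simp add: q_hat_def)
  have N: "0 < ?N" using n by simp
  then have q0: "0 < ?q"
    using qh n unfolding q_val_def prod_diff_eq_fact_choose by (intro mult_pos_pos divide_pos_pos) auto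
  have sub: "card E \<le> ?q * ?N" if E: "E \<subseteq> ?S" "?G E \<in> A" for E
  proof -
    have "r_graph r (?G E)" using E by (auto simp: r_graph_def r_sets_def)
    then have "hom_density n (single_edge r) (adj_tensor (?G E)) ^ ?e \<le> hom_density n H (adj_tensor (?G E))"
      using sid n adj_tensor_sym_tensors unfolding sidorenko_def by blast
    also have "\<dots> \<le> q_hat H \<delta> p ^ ?e" using E p \<delta> e by (simp add: A_def q_hat_power)
    finally have "hom_density n (single_edge r) (adj_tensor (?G E)) \<le> q_hat H \<delta> p"
      using power_le_imp_le_base[of _ "?e - 1" "q_hat H \<delta> p"] qh e by simp
    then have "fact r * card E / real n ^ r \<le> q_hat H \<delta> p"
      using E by (simp add: hom_density_single_edge)
    then have "card E \<le> q_hat H \<delta> p * real n ^ r / fact r" using n by (simp add: field_simps)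
    then show ?thesis using n by (simp add: q_val_times_choose)
  qed
  have pr: "measure_pmf.prob (random_r_graph n r p) A = (\<Sum>E | E \<subseteq> ?S \<and> ?G E \<in> A. p ^ card E * (1 - p) ^ (?N - card E))"
    using p by (intro prob_random_r_graph) auto
  have fin: "finite {E. E \<subseteq> ?S \<and> P E}" for P by (rule finite_subset[of _ "Pow ?S"]) auto
  have "measure_pmf.prob (random_r_graph n r p) A \<le> (\<Sum>E | E \<subseteq> ?S \<and> card E \<le> ?q * ?N. p ^ card E * (1 - p) ^ (?N - card E))"
    unfolding pr
  proof (rule sum_mono2)
    show "{E. E \<subseteq> ?S \<and> ?G E \<in> A} \<subseteq> {E. E \<subseteq> ?S \<and> card E \<le> ?q * ?N}" using sub by blast
  qed (use p fin in auto)
  also have "\<dots> \<le> exp (- real ?N * I_ent p ?q)"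
    using sum_subsets_lower_tail[of ?S ?q p] q0 q p by simp
  finally have le: "measure_pmf.prob (random_r_graph n r p) A \<le> exp (- real ?N * I_ent p ?q)" .
  \<comment> \<open>The edgeless graph makes the probability positive, so that logarithms can be
    compared.\<close>
  have "?G {} \<in> A"
    using H e p \<delta> by (auto simp: A_def hom_density_adj_tensor[OF H] card_gt_0_iff)
  then have "{E. E \<subseteq> ?S \<and> ?G E \<in> A} \<noteq> {}" by blast
  then have "0 < (\<Sum>E | E \<subseteq> ?S \<and> ?G E \<in> A. p ^ card E * (1 - p) ^ (?N - card E))"
    by (intro sum_pos fin) (use p in simp_all)
  then have "ln (measure_pmf.prob (random_r_graph n r p) A) \<le> - real ?N * I_ent p ?q"
    using ln_mono[OF le] by (simp add: pr)
  then show ?thesis by (simp add: LT_rate_def A_def)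
qed

text \<open>The error budget for fixed \<epsilon>: \<open>q\<close> exceeds \<open>a\<close> by a
  factor at most \<open>1 + \<epsilon> / 4\<close> and rounding adds at most
  \<open>\<epsilon> / 4 * a\<close>, so the edge density stays below
  \<open>(1 - \<epsilon> / 2) * a\<close>. Degenerate maps cost a factor
  \<open>1 + \<epsilon> / 4\<close>, which leaves the mean at most \<open>1 - \<epsilon> / 4\<close>
  times the threshold, as Markov's inequality needs.\<close>

lemma LT_rate_le_I_ent:
  fixes H :: "'v hypergraph" and \<epsilon> \<delta> p :: real and n r :: nat
  defines "a \<equiv> q_hat H \<delta> p" and "q \<equiv> q_val n r H \<delta> p" and "v \<equiv> card (verts H)"
  assumes H: "r_graph r H" and e: "card (edges H) > 0" and \<delta>: "\<delta> < 1" and p: "0 < p" "p < 1"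
    and n: "1 \<le> n" "r \<le> n" and \<epsilon>: "0 < \<epsilon>" "\<epsilon> < 1"
    and q: "a \<le> q" "q \<le> (1 + \<epsilon> / 4) * a" "q \<le> p"
    and large: "1 \<le> \<epsilon> / 4 * a * real (n choose r)"
    and y: "1 \<le> real n * ((1 - \<epsilon>) * a) ^ max_degree H"
      "real (v ^ (v + 1)) \<le> \<epsilon> / 4 * (real n * ((1 - \<epsilon>) * a) ^ max_degree H)"
    and err: "ln (real (n choose r) + 1) - ln (\<epsilon> / 4)
      \<le> \<epsilon> * (real (n choose r) * p * ((1 - \<epsilon>) * ln (1 - \<epsilon>) + 1 - (1 - \<epsilon>)))"
  shows "LT_rate n r p H \<delta> \<le> (1 + \<epsilon>) * real (n choose r) * I_ent p ((1 - \<epsilon>) * q)"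
proof -
  let ?N = "n choose r" and ?S = "r_sets n r" and ?e = "card (edges H)" and ?d = "max_degree H"
  let ?f = "\<lambda>E. hom_density n H (adj_tensor \<lparr>verts = {1..n}, edges = E\<rparr>)"
  \<comment> \<open>Rounding up keeps \<open>x\<close> above \<open>(1 - \<epsilon>) * q\<close>,
    the right direction as the entropy decreases below \<open>p\<close>.\<close>
  define m where "m = nat \<lceil>(1 - \<epsilon>) * q * ?N\<rceil>"
  define x where "x = real m / real ?N"
  define z where "z = real n * x ^ ?d"
  have N: "0 < real ?N" using n by simp
  have a: "0 < a" using p \<delta> by (simp add: a_def q_hat_def)
  then have q0: "0 < (1 - \<epsilon>) * q" using q \<epsilon> by auto
  have m_bounds: "(1 - \<epsilon>) * q * ?N \<le> real m" "real m \<le> (1 - \<epsilon>) * q * ?N + 1"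
    using mult_pos_pos[OF q0 N] unfolding m_def by linarith+
  have x_lower: "(1 - \<epsilon>) * q \<le> x" using m_bounds(1) N by (simp add: x_def pos_le_divide_eq)
  have "x \<le> (1 - \<epsilon>) * q + 1 / ?N" using m_bounds(2) N by (simp add: x_def field_simps)
  also have "1 / real ?N \<le> \<epsilon> / 4 * a" using large N by (simp add: field_simps)
  also have "(1 - \<epsilon>) * q \<le> (1 - \<epsilon>) * ((1 + \<epsilon> / 4) * a)" using q \<epsilon> by (intro mult_left_mono) auto
  also have "\<dots> \<le> (1 - 3 * \<epsilon> / 4) * a"
  proof -
    have "(1 - \<epsilon>) * (1 + \<epsilon> / 4) \<le> 1 - 3 * \<epsilon> / 4" by (simp add: algebra_simps)
    from mult_right_mono[OF this less_imp_le[OF a]] show ?thesis by (simp only: mult.assoc)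
  qed
  finally have x_upper: "x \<le> (1 - \<epsilon> / 2) * a" by (simp add: algebra_simps)
  also have "\<dots> < 1 * a" using a \<epsilon> by (intro mult_strict_right_mono) auto
  finally have x_less: "x < a" by simp
  then have xp: "x < p" using q by linarith
  have x0: "0 < x" using x_lower q0 by linarith
  have m0: "0 < m" using x0 by (cases "m = 0") (auto simp: x_def)
  have mN: "m < ?N"
  proof -
    have "x < 1" using xp p by linarith
    then show ?thesis using N by (simp only: x_def divide_less_eq_1_pos of_nat_less_iff)
  qed
  \<comment> \<open>The size conditions are assumed at \<open>(1 - \<epsilon>) * a\<close>, which
    lies below \<open>x\<close>, so they carry over to \<open>z\<close>.\<close>
  have zy: "real n * ((1 - \<epsilon>) * a) ^ ?d \<le> z"
  proof -
    have "(1 - \<epsilon>) * a \<le> (1 - \<epsilon>) * q" using q \<epsilon> by (intro mult_left_mono) auto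
    then have "(1 - \<epsilon>) * a \<le> x" using x_lower by linarith
    then show ?thesis unfolding z_def using \<epsilon> a by (intro mult_left_mono power_mono) auto
  qed
  then have z1: "1 \<le> z" using y by linarith
  have "\<epsilon> / 4 * (real n * ((1 - \<epsilon>) * a) ^ ?d) \<le> \<epsilon> / 4 * z"
    using zy \<epsilon> by (intro mult_left_mono) auto
  then have "real (v ^ (v + 1)) \<le> \<epsilon> / 4 * z" using y by linarith
  then have vz: "1 + real (v ^ (v + 1)) / z \<le> 1 + \<epsilon> / 4" using z1 by (simp add: divide_le_eq)
  have "x ^ ?e * (1 + real (v ^ (v + 1)) / z) \<le> a ^ ?e * (1 - \<epsilon> / 4)"
  proof -
    have "x ^ ?e * (1 + real (v ^ (v + 1)) / z) \<le> ((1 - \<epsilon> / 2) * a) ^ ?e * (1 + \<epsilon> / 4)"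
      using x_upper x0 vz z1 \<epsilon> by (intro mult_mono power_mono) auto
    also have "\<dots> = a ^ ?e * ((1 - \<epsilon> / 2) ^ ?e * (1 + \<epsilon> / 4))" by (simp add: power_mult_distrib)
    also have "\<dots> \<le> a ^ ?e * ((1 - \<epsilon> / 2) * (1 + \<epsilon> / 4))"
    proof -
      have "(1 - \<epsilon> / 2) ^ ?e \<le> (1 - \<epsilon> / 2) ^ 1" using e \<epsilon> by (intro power_decreasing) auto
      then show ?thesis using a \<epsilon> by (intro mult_left_mono mult_right_mono) auto
    qed
    also have "\<dots> \<le> a ^ ?e * (1 - \<epsilon> / 4)" using a by (intro mult_left_mono) (auto simp: algebra_simps)
    finally show ?thesis .
  qed
  then have "real (?N choose m) * (x ^ ?e * (1 + real (v ^ (v + 1)) / z)) \<le>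
      real (?N choose m) * (a ^ ?e * (1 - \<epsilon> / 4))"
    by (intro mult_left_mono) auto
  moreover have "(\<Sum>E | E \<subseteq> ?S \<and> card E = m. ?f E) \<le>
      real (?N choose m) * (x ^ ?e * (1 + real (v ^ (v + 1)) / z))"
    unfolding v_def using H n(1) m0 mN z1 by (intro sum_hom_density_le) (auto simp: x_def z_def)
  moreover have card_m: "card {E. E \<subseteq> ?S \<and> card E = m} = ?N choose m"
    using n_subsets[of ?S m] by simp
  ultimately have "(\<Sum>E | E \<subseteq> ?S \<and> card E = m. ?f E) \<le>
      real (card {E. E \<subseteq> ?S \<and> card E = m}) * (a ^ ?e * (1 - \<epsilon> / 4))"
    by simp
  then have "\<epsilon> / 4 * real (card {E. E \<subseteq> ?S \<and> card E = m}) \<le>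
      real (card {E \<in> {E. E \<subseteq> ?S \<and> card E = m}. ?f E \<le> a ^ ?e})"
    using a hom_density_adj_nonneg[OF H]
    by (intro card_sum_Markov) (auto intro: finite_subset[of _ "Pow ?S"])
  moreover have "a ^ ?e = (1 - \<delta>) * p ^ ?e" unfolding a_def using p \<delta> e by (simp add: q_hat_power)
  ultimately have "LT_rate n r p H \<delta> \<le> real ?N * I_ent p x + ln (real ?N + 1) - ln (\<epsilon> / 4)"
    using p m0 mN \<epsilon> by (intro LT_rate_le[where m = m]) (auto simp: x_def card_m)
  also have "real ?N * I_ent p x \<le> real ?N * I_ent p ((1 - \<epsilon>) * q)"
    using p q0 x_lower xp by (intro mult_left_mono I_ent_antimono) auto
  finally have "LT_rate n r p H \<delta> \<le> real ?N * I_ent p ((1 - \<epsilon>) * q) +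
      \<epsilon> * (real ?N * p * ((1 - \<epsilon>) * ln (1 - \<epsilon>) + 1 - (1 - \<epsilon>)))"
    using err by linarith
  \<comment> \<open>Since \<open>q \<le> p\<close>, the entropy at
    \<open>(1 - \<epsilon>) * q\<close> dominates that at \<open>(1 - \<epsilon>) * p\<close>, which
    is at least linear in \<open>p\<close>; the additive error turns into the factor
    \<open>1 + \<epsilon>\<close>.\<close>
  also have "\<epsilon> * (real ?N * p * ((1 - \<epsilon>) * ln (1 - \<epsilon>) + 1 - (1 - \<epsilon>))) \<le>
      \<epsilon> * (real ?N * I_ent p ((1 - \<epsilon>) * q))"
  proof -
    have "p * ((1 - \<epsilon>) * ln (1 - \<epsilon>) + 1 - (1 - \<epsilon>)) \<le> I_ent p ((1 - \<epsilon>) * p)"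
      using p \<epsilon> by (intro I_ent_linear_lower) auto
    also have "\<dots> \<le> I_ent p ((1 - \<epsilon>) * q)"
    proof (rule I_ent_antimono[OF p q0])
      show "(1 - \<epsilon>) * q \<le> (1 - \<epsilon>) * p" using q \<epsilon> by (intro mult_left_mono) auto
      show "(1 - \<epsilon>) * p \<le> p" using p \<epsilon> by (simp add: mult_le_cancel_right1)
    qed
    finally show ?thesis using \<epsilon> by (simp only: mult.assoc) (intro mult_left_mono, auto)
  qed
  finally show ?thesis by (simp add: algebra_simps)
qed

section \<open>Falling factorial ratios, a diagonal argument and the asymptotic statements\<close>

lemma falling_factorial_ratio_tendsto:
  "(\<lambda>n. real n ^ r / (\<Prod>i<r. real n - real i)) \<longlonglongrightarrow> 1"
proof -
  have "(\<lambda>n. (real n - real i) / real n) \<longlonglongrightarrow> 1" for i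
  proof (rule Lim_transform_eventually)
    show "(\<lambda>n. 1 - real i / real n) \<longlonglongrightarrow> 1"
      using tendsto_diff[OF tendsto_const lim_const_over_n[of "real i"], of 1] by simp
    show "\<forall>\<^sub>F n in sequentially. 1 - real i / real n = (real n - real i) / real n"
      using eventually_gt_at_top[of 0] by eventually_elim (simp add: field_simps)
  qed
  then have "(\<lambda>n. inverse (\<Prod>i<r. (real n - real i) / real n)) \<longlonglongrightarrow> inverse (\<Prod>i<r. 1)"
    by (intro tendsto_inverse tendsto_prod) auto
  moreover have "inverse (\<Prod>i<r. (real n - real i) / real n) = real n ^ r / (\<Prod>i<r. real n - real i)" for n
    by (simp add: prod_dividef)
  ultimately show ?thesis by simp
qed

lemma falling_factorial_ratio_ge_1:
  assumes "r \<le> n"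
  shows "1 \<le> real n ^ r / (\<Prod>i<r. real n - real i)"
proof -
  have "(\<Prod>i<r. real n - real i) \<le> (\<Prod>i<r. real n)" using assms by (intro prod_mono) auto
  moreover have "0 < (\<Prod>i<r. real n - real i)" using assms by (intro prod_pos) auto
  ultimately show ?thesis by (simp add: le_divide_eq_1)
qed

text \<open>Each \<open>1 / (k + 2)\<close> works from some index \<open>M k\<close> on. Taking at
  \<open>n\<close> the largest \<open>k \<le> n\<close> with \<open>M k \<le> n\<close> gives a null
  sequence that works from \<open>M 0\<close> on.\<close>

lemma eventually_diagonal:
  assumes "\<And>\<epsilon>::real. 0 < \<epsilon> \<Longrightarrow> \<epsilon> < 1 \<Longrightarrow> \<forall>\<^sub>F n in sequentially. P \<epsilon> n"
  shows "\<exists>\<eta>. (\<forall>n. 0 \<le> \<eta> n) \<and> \<eta> \<longlonglongrightarrow> 0 \<and> (\<forall>\<^sub>F n in sequentially. P (\<eta> n) n)"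
proof -
  define \<epsilon> where "\<epsilon> k = 1 / (real k + 2)" for k
  have "\<forall>\<^sub>F n in sequentially. P (\<epsilon> k) n" for k by (rule assms) (auto simp: \<epsilon>_def)
  then have "\<forall>k. \<exists>M. \<forall>n\<ge>M. P (\<epsilon> k) n" by (simp add: eventually_sequentially)
  then obtain M where M: "\<And>k n. M k \<le> n \<Longrightarrow> P (\<epsilon> k) n" by metis
  define S where "S n = {k. k \<le> n \<and> M k \<le> n}" for n
  \<comment> \<open>Below \<open>M 0\<close> the set can be empty and \<open>K n\<close>
    unspecified; \<open>\<epsilon>\<close> is nonnegative at every index all the same.\<close>
  define K where "K n = Max (S n)" for n
  have fin: "finite (S n)" for n by (rule finite_subset[of _ "{..n}"]) (auto simp: S_def)
  have ev: "\<forall>\<^sub>F n in sequentially. P (\<epsilon> (K n)) n"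
    using eventually_ge_at_top[of "M 0"]
  proof eventually_elim
    case (elim n)
    then have "S n \<noteq> {}" by (auto simp: S_def)
    then have "K n \<in> S n" unfolding K_def using fin by (intro Max_in)
    then show ?case by (intro M) (simp add: S_def)
  qed
  have K: "filterlim K at_top sequentially"
    unfolding filterlim_at_top
  proof
    fix k
    show "\<forall>\<^sub>F n in sequentially. k \<le> K n"
      using eventually_ge_at_top[of "max k (M k)"]
      by eventually_elim (auto simp: K_def S_def intro!: Max_ge fin[unfolded S_def])
  qed
  have "\<epsilon> \<longlonglongrightarrow> 0"
    unfolding \<epsilon>_def[abs_def]
    using LIMSEQ_ignore_initial_segment[OF lim_const_over_n[of 1], of 2] by (simp add: add.commute)
  from filterlim_compose[OF this K] have "(\<lambda>n. \<epsilon> (K n)) \<longlonglongrightarrow> 0" .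
  with ev show ?thesis by (intro exI[of _ "\<lambda>n. \<epsilon> (K n)"]) (auto simp: \<epsilon>_def)
qed

theorem theorem10p2:
  fixes r :: nat and H :: "'v hypergraph" and \<delta> :: real and p :: "nat \<Rightarrow> real"
  assumes "r \<ge> 2" and "r_graph r H" and "edges H \<noteq> {}"
    and "0 < \<delta>" and "\<delta> < 1"
    and "\<And>n. n \<ge> 1 \<Longrightarrow> 0 < p n \<and> p n < 1"
    and "filterlim (\<lambda>n. p n / real n powr (- 1 / real (max_degree H))) at_top sequentially"
  shows "(\<exists>\<eta>. (\<forall>n. 0 \<le> \<eta> n) \<and> \<eta> \<longlonglongrightarrow> 0 \<and>
            (\<forall>\<^sub>F n in sequentially.
               LT_rate n r (p n) H \<delta>
                 \<le> (1 + \<eta> n) * real (n choose r) * I_ent (p n) ((1 - \<eta> n) * q_val n r H \<delta> (p n))))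
       \<and> (sidorenko r H \<longrightarrow>
            (\<forall>\<^sub>F n in sequentially.
               LT_rate n r (p n) H \<delta> \<ge> real (n choose r) * I_ent (p n) (q_val n r H \<delta> (p n))))"
proof -
  let ?e = "card (edges H)" and ?d = "max_degree H" and ?v = "card (verts H)"
  note H = assms(2) and \<delta> = assms(4,5) and p = assms(6)
  \<comment> \<open>Thus \<open>q_hat\<close> is \<open>b * p\<close> and \<open>q_val\<close> is
    \<open>b * p * \<rho>\<close> with \<open>\<rho>\<close> tending to 1. By assumption
    \<open>g\<close> tends to infinity, and \<open>n * p ^ ?d = g ^ ?d\<close> for
    \<open>n \<ge> 1\<close>.\<close>
  define b where "b = (1 - \<delta>) powr (1 / real ?e)"
  define \<rho> where "\<rho> n = real n ^ r / (\<Prod>i<r. real n - real i)" for n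
  define g where "g n = p n / real n powr (- 1 / real ?d)" for n
  have e: "0 < ?e" using assms(3) r_graph_finite(2)[OF H] by (simp add: card_gt_0_iff)
  \<comment> \<open>As \<open>r \<ge> 2\<close>, an edge is nonempty and supplies a vertex of
    positive degree; hence \<open>n powr (- 1 / ?d)\<close> is at least
    \<open>1 / n\<close>.\<close>
  have d: "1 \<le> ?d"
  proof -
    obtain f where f: "f \<in> edges H" using assms(3) by blast
    then have "f \<noteq> {}" "f \<subseteq> verts H" using H assms(1) by (auto simp: r_graph_def)
    then obtain w where w: "w \<in> f" "w \<in> verts H" by blast
    then have "0 < vertex_degree H w"
      using f r_graph_finite(2)[OF H] by (auto simp: vertex_degree_def card_gt_0_iff)
    then show ?thesis using vertex_degree_le_max_degree[OF H w(2)] by linarith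
  qed
  have b: "0 < b" "b < 1"
    using \<delta> e powr_less_mono2[of "1 / real ?e" "1 - \<delta>" 1] by (auto simp: b_def)
  have qh: "q_hat H \<delta> x = b * x" for x by (simp add: q_hat_def b_def)
  have q: "q_val n r H \<delta> x = b * x * \<rho> n" for n x by (simp add: q_val_def qh \<rho>_def)
  have \<rho>_lim: "\<rho> \<longlonglongrightarrow> 1" using falling_factorial_ratio_tendsto by (simp add: \<rho>_def[abs_def])
  have \<rho>_le: "\<forall>\<^sub>F n in sequentially. \<rho> n \<le> c" if "1 < c" for c
    using order_tendstoD(2)[OF \<rho>_lim that] by eventually_elim simp
  have g_ge: "\<forall>\<^sub>F n in sequentially. c \<le> g n" for c
    using assms(7) by (simp add: filterlim_at_top g_def)
  \<comment> \<open>The gap \<open>b < 1\<close> leaves room for \<open>\<rho>\<close>, which is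
    eventually at most \<open>1 / b\<close>.\<close>
  have qp: "\<forall>\<^sub>F n in sequentially. q_val n r H \<delta> (p n) \<le> p n"
    using \<rho>_le[of "1 / b", unfolded less_divide_eq_1_pos[OF b(1)], OF b(2)] eventually_ge_at_top[of 1]
  proof eventually_elim
    case (elim n)
    have "b * \<rho> n \<le> 1" using elim(1) b by (simp add: field_simps)
    then show ?case using p[OF elim(2)] by (simp add: q mult_ac mult_left_le)
  qed
  \<comment> \<open>Since \<open>r \<ge> 2\<close>, \<open>n choose r\<close> is at least of order
    \<open>n ^ 2\<close>, while \<open>p\<close> is at least \<open>1 / n\<close>; the expected
    number of edges grows at least linearly.\<close>
  have Np: "\<forall>\<^sub>F n in sequentially. real n / (2 * fact r) \<le> real (n choose r) * p n"
    using \<rho>_le[of 2, simplified] g_ge[of 1] eventually_ge_at_top[of "max 1 r"]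
  proof eventually_elim
    case (elim n)
    have n: "1 \<le> n" "r \<le> n" using elim by auto
    have "real n ^ 2 \<le> real n ^ r" using n assms(1) by (intro power_increasing) auto
    also have "\<dots> = \<rho> n * (fact r * real (n choose r))"
      using n by (simp add: \<rho>_def prod_diff_eq_fact_choose)
    also have "\<dots> \<le> 2 * (fact r * real (n choose r))" using elim by (intro mult_right_mono) auto
    finally have *: "real n ^ 2 \<le> 2 * fact r * real (n choose r)" by simp
    have "real n powr (- 1) \<le> real n powr (- 1 / real ?d)" using n d by (intro powr_mono) (auto simp: field_simps)
    also have "\<dots> \<le> p n" using elim(2) n by (simp add: g_def le_divide_eq)
    finally have "1 / real n \<le> p n" using n by (simp add: powr_minus_divide)
    with * have "real n ^ 2 * (1 / real n) \<le> 2 * fact r * real (n choose r) * p n"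
      using n by (intro mult_mono) auto
    then show ?case using n by (simp add: power2_eq_square field_simps)
  qed
  have lin: "\<forall>\<^sub>F n in sequentially. c * real (n choose r) * p n \<ge> C" if "0 < c" for c C
  proof -
    have "\<forall>\<^sub>F n in sequentially. C * (2 * fact r) / c \<le> real n"
      using filterlim_real_sequentially by (simp add: filterlim_at_top)
    with Np show ?thesis
    proof eventually_elim
      case (elim n)
      have "C \<le> c * (real n / (2 * fact r))" using elim(2) that by (simp add: field_simps)
      also have "\<dots> \<le> c * (real (n choose r) * p n)" using elim(1) that by (intro mult_left_mono) auto
      finally show ?case by (simp add: mult_ac)
    qed
  qed
  have "\<forall>\<^sub>F n in sequentially. LT_rate n r (p n) H \<delta> \<le>
      (1 + \<epsilon>) * real (n choose r) * I_ent (p n) ((1 - \<epsilon>) * q_val n r H \<delta> (p n))"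
    if \<epsilon>: "0 < \<epsilon>" "\<epsilon> < 1" for \<epsilon>
  proof -
    define \<kappa> where "\<kappa> = (1 - \<epsilon>) * ln (1 - \<epsilon>) + 1 - (1 - \<epsilon>)"
    define B where "B = ((1 - \<epsilon>) * b) ^ ?d"
    \<comment> \<open>One threshold for both size conditions of
      \<open>LT_rate_le_I_ent\<close>.\<close>
    define D where "D = max 1 (4 * real (?v ^ (?v + 1)) / \<epsilon>)"
    have \<kappa>: "0 < \<kappa>" unfolding \<kappa>_def using \<epsilon> by (intro rate_pos) auto
    have B: "0 < B" using \<epsilon> b by (simp add: B_def)
    have y: "\<forall>\<^sub>F n in sequentially. D \<le> real n * ((1 - \<epsilon>) * (b * p n)) ^ ?d"
      using g_ge[of 1] g_ge[of "D / B"] eventually_ge_at_top[of 1]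
    proof eventually_elim
      case (elim n)
      have "p n = g n * real n powr (- 1 / real ?d)" using elim(3) by (simp add: g_def)
      moreover have "(real n powr (- 1 / real ?d)) ^ ?d = 1 / real n"
        using elim(3) d powr_minus_divide[of "real n" 1] by (subst powr_power) auto
      ultimately have "real n * p n ^ ?d = g n ^ ?d" using elim(3) by (simp add: power_mult_distrib)
      then have "real n * ((1 - \<epsilon>) * (b * p n)) ^ ?d = B * g n ^ ?d"
        by (simp add: B_def power_mult_distrib mult_ac)
      moreover have "g n ^ 1 \<le> g n ^ ?d" using elim(1) d by (intro power_increasing) auto
      then have "B * g n \<le> B * g n ^ ?d" using B by (intro mult_left_mono) auto
      moreover have "D \<le> B * g n" using elim(2) B by (simp add: field_simps)
      ultimately show ?case by linarith
    qed
    \<comment> \<open>By \<open>n choose r \<le> n ^ r\<close> the left side is at most logarithmic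
      in \<open>n\<close>, while the right side is at least linear by \<open>Np\<close>.\<close>
    have err: "\<forall>\<^sub>F n in sequentially. ln (real (n choose r) + 1) - ln (\<epsilon> / 4) \<le> \<epsilon> * (real (n choose r) * p n * \<kappa>)"
    proof -
      have "(\<lambda>n. (ln 2 - ln (\<epsilon> / 4)) / real n + real r * (ln (real n) / real n)) \<longlonglongrightarrow> 0 + real r * 0"
        by (intro tendsto_add tendsto_mult tendsto_const lim_const_over_n lim_ln_over_n)
      then have "\<forall>\<^sub>F n in sequentially. (ln 2 - ln (\<epsilon> / 4)) / real n + real r * (ln (real n) / real n) < \<epsilon> * \<kappa> / (2 * fact r)"
        using \<epsilon> \<kappa> by (intro order_tendstoD(2)) auto
      with Np eventually_ge_at_top[of "max 1 r"] show ?thesis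
      proof eventually_elim
        case (elim n)
        then have n: "1 \<le> n" "r \<le> n" by auto
        have "real (n choose r) \<le> real (n ^ r)"
          using binomial_le_pow[OF n(2)] by (simp only: of_nat_le_iff)
        moreover have "1 \<le> real n ^ r" using n by simp
        ultimately have "real (n choose r) + 1 \<le> 2 * real n ^ r" unfolding of_nat_power by linarith
        then have "ln (real (n choose r) + 1) \<le> ln (2 * real n ^ r)" by (intro ln_mono) auto
        also have "\<dots> = ln 2 + real r * ln (real n)" using n by (simp add: ln_mult ln_realpow)
        finally have "ln (real (n choose r) + 1) - ln (\<epsilon> / 4) \<le>
            real n * ((ln 2 - ln (\<epsilon> / 4)) / real n + real r * (ln (real n) / real n))"
          using n by (simp add: distrib_left)
        also have "\<dots> \<le> real n * (\<epsilon> * \<kappa> / (2 * fact r))" using elim(3) by (intro mult_left_mono) auto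
        also have "\<dots> = \<epsilon> * \<kappa> * (real n / (2 * fact r))" by simp
        also have "\<dots> \<le> \<epsilon> * \<kappa> * (real (n choose r) * p n)" using elim(1) \<epsilon> \<kappa> by (intro mult_left_mono) auto
        finally show ?case by (simp add: mult_ac)
      qed
    qed
    \<comment> \<open>With the first constant, \<open>lin\<close> makes the rounding error
      \<open>1 / (n choose r)\<close> at most \<open>\<epsilon> / 4\<close> times
      \<open>q_hat\<close>; the second bounds \<open>\<rho>\<close>.\<close>
    have "0 < \<epsilon> / 4 * b" "1 < 1 + \<epsilon> / 4" using \<epsilon> b by auto
    from lin[OF this(1), of 1] \<rho>_le[OF this(2)] y err qp eventually_ge_at_top[of "max 1 r"]
    show ?thesis
    proof eventually_elim
      case (elim n)
      then have n: "1 \<le> n" "r \<le> n" by auto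
      note pn = p[OF n(1)]
      have bp: "0 < b * p n" using b pn by simp
      show ?case
      proof (rule LT_rate_le_I_ent[OF H e \<delta>(2) _ _ n \<epsilon>])
        show "0 < p n" "p n < 1" using pn by auto
        show "q_hat H \<delta> (p n) \<le> q_val n r H \<delta> (p n)"
          using mult_left_mono[OF falling_factorial_ratio_ge_1[OF n(2)], of "b * p n"] bp by (simp add: qh q \<rho>_def)
        show "q_val n r H \<delta> (p n) \<le> (1 + \<epsilon> / 4) * q_hat H \<delta> (p n)"
          using mult_left_mono[OF elim(2), of "b * p n"] bp by (simp add: qh q mult_ac)
        show "q_val n r H \<delta> (p n) \<le> p n" by (rule elim(5))
        show "1 \<le> \<epsilon> / 4 * q_hat H \<delta> (p n) * real (n choose r)" using elim(1) by (simp add: qh mult_ac)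
        have "1 \<le> D" "real (?v ^ (?v + 1)) \<le> \<epsilon> / 4 * D" using \<epsilon> by (simp_all add: D_def field_simps max_def)
        moreover have "\<epsilon> / 4 * D \<le> \<epsilon> / 4 * (real n * ((1 - \<epsilon>) * (b * p n)) ^ ?d)"
          using elim(3) \<epsilon> by (intro mult_left_mono) auto
        ultimately show "1 \<le> real n * ((1 - \<epsilon>) * q_hat H \<delta> (p n)) ^ ?d"
          "real (?v ^ (?v + 1)) \<le> \<epsilon> / 4 * (real n * ((1 - \<epsilon>) * q_hat H \<delta> (p n)) ^ ?d)"
          using elim(3) unfolding qh by linarith+
      qed (use elim(4) in \<open>simp add: \<kappa>_def\<close>)
    qed
  qed
  then have "\<exists>\<eta>. (\<forall>n. 0 \<le> \<eta> n) \<and> \<eta> \<longlonglongrightarrow> 0 \<and> (\<forall>\<^sub>F n in sequentially. LT_rate n r (p n) H \<delta> \<le>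
      (1 + \<eta> n) * real (n choose r) * I_ent (p n) ((1 - \<eta> n) * q_val n r H \<delta> (p n)))"
    by (rule eventually_diagonal)
  moreover have "\<forall>\<^sub>F n in sequentially.
      LT_rate n r (p n) H \<delta> \<ge> real (n choose r) * I_ent (p n) (q_val n r H \<delta> (p n))" if "sidorenko r H"
    using qp eventually_ge_at_top[of "max 1 r"]
    by eventually_elim (use p in \<open>auto intro!: LT_rate_ge[OF H e that \<delta>(2)]\<close>)
  ultimately show ?thesis by blast
qed

end
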